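(* For every $\mu\in\mathbb{N}$, $$\gamma(1,1;\mu)=\frac{1}{\mu}\gamma+\sum_{j=0}^{\mu-2}\binom{\mu-1}{j}\log A_{j}.$$ Consequently, $$D(1,1;\mu)=H_{\mu}-\frac{1}{\mu}\gamma-\sum_{j=0}^{\mu-2}\binom{\mu-1}{j}\log A_{j}.$$ Here the sum over $j$ is understood to be empty (equal to $0$) when $\mu=1$.
   Context: $\mathbb{N}=\{1,2,3,\dots\}$, $\mathbb{N}_0=\mathbb{N}\cup\{0\}$, $\zeta$ is the Riemann zeta function, $\gamma=\lim_{n\to\infty}\left(\sum_{k=1}^n \frac1k-\log n\right)$ is the Euler--Mascheroni constant, and $H_\mu=\sum_{k=1}^\mu \frac1k$. For $s_1,s_2\in\mathbb{C}$ with $s_1\notin\mathbb{Z}_{\le 0}$ and $\lambda\in\mathbb{C}$ with $\lambda\notin\mathbb{Z}_{<0}$, $$D(s_1,s_2;\lambda):=\sum_{k=1}^{\infty}\frac{\zeta(s_1+k)-1}{(k+\lambda)^{s_2}}.$$ For $\alpha,\beta\in\mathbb{C}$ with $\Re(\alpha)>0$ and $\mu\in\mathbb{N}_0$, the generalized Euler constant is $$\gamma(\alpha,\beta;\mu):=\lim_{N\to\infty}\left\{\sum_{l=1}^{\mu}\frac{1}{l^{\beta}}\sum_{k=1}^{N}\frac{1}{k^{\alpha+l-\mu}}-\sum_{k=2}^{N}\mathrm{Li}_{\beta}\!\left(\frac1k\right)k^{\mu-\alpha}\right\},$$ where $\mathrm{Li}_s(z)=\sum_{l=1}^{\infty}z^l/l^s$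 is the polylogarithm; when $\mu=0$ the sum over $l$ from $1$ to $\mu$ is omitted. The Bendersky constants $A_m$ ($m\in\mathbb{N}_0$; $A_0=\sqrt{2\pi}$ is the Stirling constant and $A_1$ the Glaisher--Kinkelin constant) are defined by $$\log A_m:=\lim_{n\to\infty}\left\{\sum_{k=1}^{n}k^{m}\log k-p(n,m)\right\},$$ where $$p(n,m)=\left(\frac{n^{m+1}}{m+1}+\frac{n^{m}}{2}\right)\log n-\frac{n^{m+1}}{(m+1)^2}+m!\sum_{r=1}^{m}\frac{B_{r+1}}{(r+1)!}\frac{n^{m-r}}{(m-r)!}\left(\log n+(1-\delta_{m,r})\sum_{i=1}^{r}\frac{1}{m-i+1}\right),$$ $B_j$ is the $j$th Bernoulli number, $\delta_{m,r}$ is the Kronecker delta, and the sum over $r$ is omitted when $m=0$. *)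

theory Defs
  imports
    "HOL-Complex_Analysis.Complex_Analysis"
    "HOL-Computational_Algebra.Computational_Algebra"
begin

text \<open>
  The Riemann zeta function: the Dirichlet series where it converges absolutely, and its analytic
  continuation elsewhere. The continuation is determined at every point except the pole at \<open>1\<close>,
  where the value is unspecified.
\<close>

definition riemann_zeta :: "complex \<Rightarrow> complex" where
  "riemann_zeta s =
     (if Re s > 1 then (\<Sum>n. 1 / of_nat (Suc n) powr s)
      else (THE z. \<exists>f. f holomorphic_on (- {1}) \<and>
                       (\<forall>w. Re w > 1 \<longrightarrow> f w = (\<Sum>n. 1 / of_nat (Suc n) powr w)) \<and>
                       z = f s))"

text \<open>In the next three definitions complex powers take the principal branch.\<close>

definition D_series :: "complex \<Rightarrow> complex \<Rightarrow> complex \<Rightarrow> complex" where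
  "D_series s1 s2 lam =
     (\<Sum>k. (riemann_zeta (s1 + of_nat (Suc k)) - 1) / (of_nat (Suc k) + lam) powr s2)"

definition polylog :: "complex \<Rightarrow> complex \<Rightarrow> complex" where
  "polylog s z = (\<Sum>l. z ^ Suc l / of_nat (Suc l) powr s)"

definition gen_euler_const :: "complex \<Rightarrow> complex \<Rightarrow> nat \<Rightarrow> complex" where
  "gen_euler_const \<alpha> \<beta> \<mu> =
     lim (\<lambda>N. (\<Sum>l = 1..\<mu>. 1 / of_nat l powr \<beta> *
                   (\<Sum>k = 1..N. 1 / of_nat k powr (\<alpha> + of_nat l - of_nat \<mu>)))
              - (\<Sum>k = 2..N. polylog \<beta> (1 / of_nat k) * of_nat k powr (of_nat \<mu> - \<alpha>)))"

text \<open>Bernoulli numbers, by their exponential generating function \<open>t / (exp t - 1)\<close>.\<close>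

definition bernoulli_num :: "nat \<Rightarrow> real" where
  "bernoulli_num j = fact j * fps_nth (fps_X / (fps_exp 1 - 1)) j"

definition bendersky_p :: "nat \<Rightarrow> nat \<Rightarrow> real" where
  "bendersky_p n m =
     (real n ^ (m + 1) / real (m + 1) + real n ^ m / 2) * ln (real n)
     - real n ^ (m + 1) / real (m + 1) ^ 2
     + fact m * (\<Sum>r = 1..m. bernoulli_num (r + 1) / fact (r + 1) *
                   (real n ^ (m - r) / fact (m - r)) *
                   (ln (real n) + (1 - (if m = r then 1 else 0)) *
                                  (\<Sum>i = 1..r. 1 / real (m - i + 1))))"

definition bendersky_const :: "nat \<Rightarrow> real" where
  "bendersky_const m =
     exp (lim (\<lambda>n. (\<Sum>k = 1..n. real k ^ m * ln (real k)) - bendersky_p n m))"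

end

theory Submission
  imports Defs
begin

text \<open>
  Abel summation turns the sequence defining \<open>\<gamma>(1, 1; \<mu>)\<close> into \<open>H\<^sub>N / \<mu>\<close> plus the binomial
  combination of the sums \<open>\<Sum>k\<le>N. k^j ln k\<close>, up to terms \<open>A(N) ln N + R(N)\<close> with polynomials
  \<open>A\<close> and \<open>R\<close>. Subtracting \<open>ln N\<close> and the Bendersky polynomials again leaves an expression
  \<open>A(N) ln N + R(N)\<close>. No Bernoulli number identity is needed to evaluate it: it converges, because
  all other terms do, and so \<open>A = 0\<close> and \<open>R\<close> is constant; since \<open>R(0) = 0\<close> by inspection, it
  vanishes.

  The sequence itself converges to \<open>H\<^sub>\<mu> - D(1, 1; \<mu>)\<close>, by expanding \<open>Li\<^sub>1(1/k)\<close> and exchanging the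
  two summations. The limits defining the Bendersky constants exist because the increments
  are \<open>O(n^(-2))\<close>, by Euler-Maclaurin summation on unit intervals.
\<close>

subsection \<open>Existence of the Bendersky constants\<close>

text \<open>Taylor's theorem with Lagrange remainder. The expansion gets shorter as \<open>r\<close>
  grows, so every remainder involves the same top derivative \<open>F (Suc K)\<close>; dropping its
  factorial lets one \<open>B\<close> serve all \<open>r\<close>.\<close>

lemma taylor_unit_step:
  fixes F :: "nat \<Rightarrow> real \<Rightarrow> real"
  assumes deriv: "\<And>r t. r \<le> K \<Longrightarrow> x \<le> t \<Longrightarrow> t \<le> x + 1 \<Longrightarrow>
                    (F r has_real_derivative F (Suc r) t) (at t)"
    and bound: "\<And>t. x \<le> t \<Longrightarrow> t \<le> x + 1 \<Longrightarrow> \<bar>F (Suc K) t\<bar> \<le> B"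
    and r: "r \<le> K"
  shows "\<bar>F r (x + 1) - (\<Sum>s\<le>K - r. F (r + s) x / fact s)\<bar> \<le> B"
proof -
  have "\<exists>t. x < t \<and> t < x + 1 \<and>
      F r (x + 1) = (\<Sum>s<Suc (K - r). F (r + s) x / fact s * (x + 1 - x) ^ s)
                    + F (r + Suc (K - r)) t / fact (Suc (K - r)) * (x + 1 - x) ^ Suc (K - r)"
    using r by (intro Taylor_up[where diff = "\<lambda>s. F (r + s)" and a = x]) (auto intro!: deriv)
  then obtain t where t: "x < t" "t < x + 1"
      "F r (x + 1) = (\<Sum>s\<le>K - r. F (r + s) x / fact s) + F (Suc K) t / fact (Suc (K - r))"
    using r by (auto simp: lessThan_Suc_atMost)
  have "\<bar>F (Suc K) t / fact (Suc (K - r))\<bar> \<le> \<bar>F (Suc K) t\<bar> / 1"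
    unfolding abs_divide by (intro divide_left_mono) (auto simp: fact_ge_1 simp del: fact_Suc)
  also have "\<dots> \<le> B" using bound[of t] t by simp
  finally show ?thesis using t(3) by simp
qed

text \<open>The convolution hypothesis on \<open>b\<close> is \<open>(\<Sum>r. b r D^r) (exp D - 1) = D exp D\<close>, read off
  coefficientwise; applied to Taylor expansions, it makes the Euler-Maclaurin primitive
  \<open>\<Sum>r. b r F r\<close> telescope up to the Taylor remainders.\<close>

lemma euler_maclaurin_unit_step:
  fixes F :: "nat \<Rightarrow> real \<Rightarrow> real"
  assumes deriv: "\<And>r t. r \<le> K \<Longrightarrow> x \<le> t \<Longrightarrow> t \<le> x + 1 \<Longrightarrow>
                    (F r has_real_derivative F (Suc r) t) (at t)"
    and bound: "\<And>t. x \<le> t \<Longrightarrow> t \<le> x + 1 \<Longrightarrow> \<bar>F (Suc K) t\<bar> \<le> B"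
    and conv: "\<And>n. n < K \<Longrightarrow> (\<Sum>r\<le>n. b r / fact (Suc n - r)) = 1 / fact n"
    and K: "K \<ge> 1"
  shows "\<bar>F 1 (x + 1) - (\<Sum>r<K. b r * (F r (x + 1) - F r x))\<bar> \<le> (1 + (\<Sum>r<K. \<bar>b r\<bar>)) * B"
proof -
  define R where "R r = F r (x + 1) - (\<Sum>s\<le>K - r. F (r + s) x / fact s)" for r
  have R: "\<bar>R r\<bar> \<le> B" if "r \<le> K" for r
    unfolding R_def using taylor_unit_step[of K x F B, OF deriv bound that] by blast
  \<comment> \<open>Indexing by \<open>n = r + s - 1\<close> groups the Taylor terms by the
    derivative \<open>F (Suc n)\<close>, as the convolution hypothesis requires after the swap of
    summations.\<close>
  have diff: "F r (x + 1) - F r x = (\<Sum>n | n \<in> {..<K} \<and> r \<le> n. F (Suc n) x / fact (Suc n - r)) + R r"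
    if "r < K" for r
  proof -
    have "(\<Sum>s\<le>K - r. F (r + s) x / fact s) = F r x + (\<Sum>s\<in>{1..K - r}. F (r + s) x / fact s)"
      by (simp add: atMost_atLeast0 sum.atLeast_Suc_atMost)
    also have "(\<Sum>s\<in>{1..K - r}. F (r + s) x / fact s)
        = (\<Sum>n | n \<in> {..<K} \<and> r \<le> n. F (Suc n) x / fact (Suc n - r))"
      by (rule sum.reindex_bij_witness[of _ "\<lambda>n. Suc n - r" "\<lambda>s. r + s - 1"]) (use that in auto)
    finally show ?thesis by (simp add: R_def)
  qed
  have F1: "F 1 (x + 1) = (\<Sum>n<K. F (Suc n) x / fact n) + R 1"
    using K by (simp add: R_def lessThan_Suc_atMost[symmetric])
  have "(\<Sum>r<K. b r * (F r (x + 1) - F r x))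
      = (\<Sum>r<K. b r * (\<Sum>n | n \<in> {..<K} \<and> r \<le> n. F (Suc n) x / fact (Suc n - r)) + b r * R r)"
    by (intro sum.cong refl) (simp only: lessThan_iff diff distrib_left)
  also have "\<dots> = (\<Sum>r<K. \<Sum>n | n \<in> {..<K} \<and> r \<le> n. b r * (F (Suc n) x / fact (Suc n - r)))
                 + (\<Sum>r<K. b r * R r)"
    by (simp add: sum.distrib sum_distrib_left)
  also have "(\<Sum>r<K. \<Sum>n | n \<in> {..<K} \<and> r \<le> n. b r * (F (Suc n) x / fact (Suc n - r)))
      = (\<Sum>n<K. \<Sum>r | r \<in> {..<K} \<and> r \<le> n. b r * (F (Suc n) x / fact (Suc n - r)))"
    by (rule sum.swap_restrict) auto
  also have "\<dots> = (\<Sum>n<K. F (Suc n) x * (\<Sum>r\<le>n. b r / fact (Suc n - r)))"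
  proof (intro sum.cong refl)
    fix n assume "n \<in> {..<K}"
    then have "{r. r \<in> {..<K} \<and> r \<le> n} = {..n}" by auto
    then show "(\<Sum>r | r \<in> {..<K} \<and> r \<le> n. b r * (F (Suc n) x / fact (Suc n - r)))
        = F (Suc n) x * (\<Sum>r\<le>n. b r / fact (Suc n - r))"
      by (simp add: sum_distrib_left mult_ac)
  qed
  also have "\<dots> = (\<Sum>n<K. F (Suc n) x / fact n)"
    by (intro sum.cong) (auto simp: conv)
  finally have "F 1 (x + 1) - (\<Sum>r<K. b r * (F r (x + 1) - F r x)) = R 1 - (\<Sum>r<K. b r * R r)"
    using F1 by simp
  also have "\<bar>\<dots>\<bar> \<le> \<bar>R 1\<bar> + (\<Sum>r<K. \<bar>b r\<bar> * \<bar>R r\<bar>)"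
    using sum_abs[of "\<lambda>r. b r * R r" "{..<K}"] by (simp add: abs_mult)
  also have "\<dots> \<le> B + (\<Sum>r<K. \<bar>b r\<bar> * B)"
    using K by (intro add_mono sum_mono mult_left_mono R) auto
  also have "\<dots> = (1 + (\<Sum>r<K. \<bar>b r\<bar>)) * B"
    by (simp add: sum_distrib_right distrib_right)
  finally show ?thesis .
qed

text \<open>The coefficients of \<open>t / (1 - exp (- t)) = t / (exp t - 1) + t\<close>, that is, the Bernoulli
  numbers with the sign convention \<open>B\<^sub>1 = 1/2\<close>, divided by factorials.\<close>

definition bern_coeff :: "nat \<Rightarrow> real" where
  "bern_coeff r = bernoulli_num r / fact r + (if r = 1 then 1 else 0)"

text \<open>Adding X to X / (exp X - 1) gives X exp X / (exp X - 1). Multiplying back by exp X - 1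
  and comparing coefficients of X^(n+1) yields the recurrence.\<close>

lemma bern_coeff_convolution: "(\<Sum>r\<le>n. bern_coeff r / fact (Suc n - r)) = 1 / fact n"
proof -
  define E :: "real fps" where "E = fps_exp 1 - 1"
  define G :: "real fps" where "G = fps_X / E"
  have E0: "E $ 0 = 0" and E1: "E $ Suc 0 = 1" by (simp_all add: E_def)
  \<comment> \<open>\<open>E\<close> has order 1 and therefore divides \<open>fps_X\<close>, so the
    quotient \<open>G\<close> is exact.\<close>
  have "subdegree E = 1" by (rule subdegreeI) (simp_all add: E0 E1)
  moreover have "E \<noteq> 0" using E1 by auto
  ultimately have "E dvd fps_X" by (simp add: fps_dvd_iff)
  then have GE: "G * E = fps_X" by (simp add: G_def)
  have coeff: "(G + fps_X) $ r = bern_coeff r" for r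
    by (simp add: bern_coeff_def bernoulli_num_def G_def E_def)
  have "(G + fps_X) * E = fps_X * fps_exp 1"
    using GE by (simp add: distrib_right) (simp add: E_def algebra_simps)
  then have "((G + fps_X) * E) $ Suc n = 1 / fact n" by simp
  moreover have "((G + fps_X) * E) $ Suc n = (\<Sum>r=0..Suc n. bern_coeff r * E $ (Suc n - r))"
    by (simp only: fps_mult_nth coeff)
  also have "\<dots> = (\<Sum>r=0..n. bern_coeff r * E $ (Suc n - r))" by (simp add: E0)
  also have "\<dots> = (\<Sum>r\<le>n. bern_coeff r / fact (Suc n - r))"
    by (intro sum.cong) (auto simp: E_def Suc_diff_le simp del: fact_Suc)
  finally show ?thesis by simp
qed

lemma bern_coeff_0: "bern_coeff 0 = 1"
  using bern_coeff_convolution[of 0] by simp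

lemma bern_coeff_1: "bern_coeff (Suc 0) = 1 / 2"
  using bern_coeff_convolution[of 1] by (simp add: bern_coeff_0 numeral_2_eq_2)

text \<open>An antiderivative of \<open>x^m ln x\<close>, followed by that function itself and its successive
  derivatives; meaningful for indices up to \<open>m + 3\<close>.\<close>

definition powln_deriv :: "nat \<Rightarrow> nat \<Rightarrow> real \<Rightarrow> real" where
  "powln_deriv m r x =
     (if r = 0 then x ^ (m + 1) / real (m + 1) * ln x - x ^ (m + 1) / real (m + 1) ^ 2
      else if r \<le> m + 1 then
        fact m / fact (m - (r - 1)) * x ^ (m - (r - 1)) * (ln x + (\<Sum>i = 1..r - 1. 1 / real (m - i + 1)))
      else if r = m + 2 then fact m / x else - fact m / x ^ 2)"

lemma powln_deriv_has_derivative: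
  assumes "x > 0" "r \<le> m + 2"
  shows "(powln_deriv m r has_real_derivative powln_deriv m (Suc r) x) (at x)"
proof -
  consider "r = 0" | q where "r = Suc q" "q < m" | "r = Suc m" | "r = m + 2"
    using assms(2) by (cases r) (auto simp: le_Suc_eq less_Suc_eq_le numeral_2_eq_2 nat_less_le)
  then show ?thesis
  proof cases
    case 1
    define c where "c = real (Suc m)"
    have "c > 0" by (simp add: c_def)
    have pow: "((\<lambda>x. x ^ Suc m) has_real_derivative c * x ^ m) (at x)"
      using DERIV_pow[of "Suc m" x] by (simp add: c_def)
    have "((\<lambda>x. x ^ Suc m / c * ln x - x ^ Suc m / c ^ 2) has_real_derivative x ^ m * ln x) (at x)"
      by (rule DERIV_cong[OF DERIV_diff[OF DERIV_mult[OF DERIV_cdivide[OF pow]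
            DERIV_ln_divide[OF assms(1)]] DERIV_cdivide[OF pow]]])
         (use \<open>c > 0\<close> assms(1) in \<open>simp add: field_simps power2_eq_square\<close>)
    then show ?thesis using 1 by (simp add: powln_deriv_def[abs_def] c_def)
  next
    case (2 q)
    define h where "h = (\<Sum>i = 1..q. 1 / real (m - i + 1))"
    obtain d where d: "m = Suc (q + d)" using 2 less_imp_Suc_add by blast
    have pow: "((\<lambda>x. x ^ Suc d) has_real_derivative real (Suc d) * x ^ d) (at x)"
      using DERIV_pow[of "Suc d" x] by simp
    have "((\<lambda>x. fact m / fact (Suc d) * (x ^ Suc d * (ln x + h))) has_real_derivative
           fact m / fact (Suc d) * (real (Suc d) * x ^ d * (ln x + h) + x ^ d)) (at x)"
      by (rule DERIV_cong[OF DERIV_cmult[OF DERIV_mult[OF pow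
            DERIV_add[OF DERIV_ln_divide[OF assms(1)] DERIV_const]]]])
         (use assms(1) in simp)
    \<comment> \<open>Absorbed into the bracket, the product-rule term \<open>x ^ d\<close> becomes
      the harmonic summand with \<open>i = q + 1\<close>, since then
      \<open>m - i + 1 = Suc d\<close>.\<close>
    also have "fact m / fact (Suc d) * (real (Suc d) * x ^ d * (ln x + h) + x ^ d)
        = fact m / fact d * x ^ d * (ln x + (h + 1 / real (Suc d)))"
      by (simp add: field_simps del: of_nat_Suc)
    finally show ?thesis using 2 d unfolding h_def by (simp add: powln_deriv_def[abs_def] Suc_diff_le mult.assoc)
  next
    case 3
    show ?thesis using 3 assms(1)
      by (auto simp: powln_deriv_def[abs_def] intro!: derivative_eq_intros)
  next
    case 4
    show ?thesis using 4 assms(1)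
      by (auto simp: powln_deriv_def[abs_def] power2_eq_square intro!: derivative_eq_intros)
  qed
qed

text \<open>The constant is the term that \<open>1 - \<delta>\<^bsub>m,r\<^esub>\<close> removes from \<open>p(n, m)\<close>.\<close>

lemma bendersky_p_eq:
  "bendersky_p n m = (\<Sum>r<m + 2. bern_coeff r * powln_deriv m r (real n))
     - fact m * bern_coeff (m + 1) * (\<Sum>i = 1..m. 1 / real (m - i + 1))"
proof -
  define h where "h r = (\<Sum>i = 1..r. 1 / real (m - i + 1))" for r
  have "(\<Sum>r<m + 2. bern_coeff r * powln_deriv m r (real n))
      = bern_coeff 0 * powln_deriv m 0 (real n) + bern_coeff 1 * powln_deriv m 1 (real n)
        + (\<Sum>r=1..m. bern_coeff (Suc r) * powln_deriv m (Suc r) (real n))"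
    by (simp add: sum.lessThan_Suc_shift sum.atLeast1_atMost_eq del: sum.lessThan_Suc)
  also have "(\<Sum>r=1..m. bern_coeff (Suc r) * powln_deriv m (Suc r) (real n))
      = (\<Sum>r=1..m. fact m * (bernoulli_num (r + 1) / fact (r + 1) *
            (real n ^ (m - r) / fact (m - r)) * (ln (real n) + h r)))"
    by (intro sum.cong) (auto simp: bern_coeff_def powln_deriv_def h_def simp del: fact_Suc)
  also have "\<dots> = (\<Sum>r=1..m. fact m * (bernoulli_num (r + 1) / fact (r + 1) *
                   (real n ^ (m - r) / fact (m - r)) *
                   (ln (real n) + (1 - (if m = r then 1 else 0)) * h r))
          + (if r = m then fact m * bern_coeff (m + 1) * h m else 0))"
    by (intro sum.cong) (auto simp: bern_coeff_def algebra_simps add_divide_distrib simp del: fact_Suc)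
  also have "\<dots> = fact m * (\<Sum>r=1..m. bernoulli_num (r + 1) / fact (r + 1) *
                   (real n ^ (m - r) / fact (m - r)) *
                   (ln (real n) + (1 - (if m = r then 1 else 0)) * h r))
          + fact m * bern_coeff (m + 1) * h m"
    \<comment> \<open>If \<open>m = 0\<close>, no summand has \<open>r = m\<close>, but
      \<open>h 0\<close> is then 0, so the extracted term still agrees.\<close>
    by (cases "m = 0") (simp_all add: sum.distrib sum_distrib_left h_def del: fact_Suc)
  finally show ?thesis
    unfolding bendersky_p_def h_def
    by (simp add: bern_coeff_0 bern_coeff_1 powln_deriv_def algebra_simps del: fact_Suc)
qed

text \<open>The constant from \<open>bendersky_p_eq\<close> cancels in the increments, leaving the
  Euler-Maclaurin defect with \<open>K = m + 2\<close>. The derivative that bounds it has size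
  m!/x^2, so the increments are summable.\<close>

lemma bendersky_convergent:
  "convergent (\<lambda>n. (\<Sum>k = 1..n. real k ^ m * ln (real k)) - bendersky_p n m)"
proof -
  define M where "M n = (\<Sum>k = 1..n. real k ^ m * ln (real k)) - bendersky_p n m" for n
  define C where "C = (1 + (\<Sum>r<m + 2. \<bar>bern_coeff r\<bar>)) * fact m"
  have step: "norm (M (Suc n) - M n) \<le> C * (1 / real n ^ 2)" if n: "n \<ge> 1" for n
  proof -
    have "M (Suc n) - M n = powln_deriv m 1 (real n + 1)
        - (\<Sum>r<m + 2. bern_coeff r * (powln_deriv m r (real n + 1) - powln_deriv m r (real n)))"
      unfolding M_def bendersky_p_eq
      by (simp add: right_diff_distrib sum_subtractf powln_deriv_def[of m "Suc 0"] add_ac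
               del: sum.lessThan_Suc)
    also have "\<bar>\<dots>\<bar> \<le> (1 + (\<Sum>r<m + 2. \<bar>bern_coeff r\<bar>)) * (fact m / real n ^ 2)"
    proof (rule euler_maclaurin_unit_step)
      show "(powln_deriv m r has_real_derivative powln_deriv m (Suc r) t) (at t)"
        if "r \<le> m + 2" "real n \<le> t" for r t
        using that n by (intro powln_deriv_has_derivative) auto
      show "\<bar>powln_deriv m (Suc (m + 2)) t\<bar> \<le> fact m / real n ^ 2" if "real n \<le> t" for t
        using that n by (auto simp: powln_deriv_def intro!: divide_left_mono power_mono)
    qed (simp_all add: bern_coeff_convolution)
    finally show ?thesis by (simp add: C_def)
  qed
  have "summable (\<lambda>n. C * (1 / real n ^ 2))"
    using inverse_power_summable[of 2, where 'a = real] by (intro summable_mult) (simp add: field_simps)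
  then have "summable (\<lambda>n. M (Suc n) - M n)"
    by (rule summable_comparison_test') (rule step)
  then obtain s where "(\<lambda>n. M (Suc n) - M n) sums s" by (auto simp: summable_def)
  then have "(\<lambda>n. M n - M 0) \<longlonglongrightarrow> s"
    by (simp add: sums_def sum_lessThan_telescope)
  then have "(\<lambda>n. M n - M 0 + M 0) \<longlonglongrightarrow> s + M 0" by (intro tendsto_intros)
  then show ?thesis unfolding M_def[symmetric] by (auto simp: convergent_def)
qed

lemma bendersky_LIMSEQ:
  "(\<lambda>n. (\<Sum>k = 1..n. real k ^ m * ln (real k)) - bendersky_p n m) \<longlonglongrightarrow> ln (bendersky_const m)"
  using bendersky_convergent[of m] by (simp add: bendersky_const_def convergent_LIMSEQ_iff)

subsection \<open>Polynomials with logarithmic terms\<close>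

lemma ln_affine_LIMSEQ_imp:
  assumes "(\<lambda>n. a * ln (real n) + r) \<longlonglongrightarrow> c"
  shows "a = 0" and "r = c"
proof -
  show "a = 0"
  proof (rule ccontr)
    assume a: "a \<noteq> 0"
    have "(\<lambda>n. (a * ln (real n) + r - r) / a) \<longlonglongrightarrow> (c - r) / a"
      using a by (intro tendsto_intros assms)
    then have "(\<lambda>n. ln (real n)) \<longlonglongrightarrow> (c - r) / a" using a by simp
    moreover have "filterlim (\<lambda>n. ln (real n)) at_top sequentially" by real_asymp
    ultimately show False
      using not_tendsto_and_filterlim_at_infinity filterlim_at_top_imp_at_infinity sequentially_bot by blast
  qed
  then show "r = c" using assms by (simp add: LIMSEQ_const_iff)
qed

text \<open>Induction on the degree. Division by n^(d+1) sends the left side's limit and all lower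
  terms to 0, as (ln n)/n tends to 0. So the leading coefficient a ln n + r tends to 0, both its
  parts vanish, and the degree drops.\<close>

lemma ln_polynomial_LIMSEQ_imp:
  assumes "(\<lambda>n. \<Sum>i\<le>d. (a i * ln (real n) + r i) * real n ^ i) \<longlonglongrightarrow> c"
  shows "c = r 0"
  using assms
proof (induction d)
  case 0
  then show ?case using ln_affine_LIMSEQ_imp(2)[of "a 0" "r 0" c] by simp
next
  case (Suc d)
  define L where "L i n = a i * ln (real n) + r i" for i and n :: nat
  have small: "(\<lambda>n. \<Sum>i\<le>d. L i n / real n * (1 / real n) ^ (d - i)) \<longlonglongrightarrow> 0"
  proof -
    have "(\<lambda>n. L i n / real n) \<longlonglongrightarrow> 0" for i unfolding L_def by real_asymp
    moreover have "(\<lambda>n. 1 / real n) \<longlonglongrightarrow> 0" by real_asymp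
    ultimately have "(\<lambda>n. \<Sum>i\<le>d. L i n / real n * (1 / real n) ^ (d - i))
        \<longlonglongrightarrow> (\<Sum>i\<le>d. 0 * 0 ^ (d - i))"
      by (intro tendsto_intros) auto
    then show ?thesis by simp
  qed
  have "(\<lambda>n. 1 / real n) \<longlonglongrightarrow> 0" by real_asymp
  then have "(\<lambda>n. (\<Sum>i\<le>Suc d. L i n * real n ^ i) * (1 / real n) ^ Suc d
           - (\<Sum>i\<le>d. L i n / real n * (1 / real n) ^ (d - i))) \<longlonglongrightarrow> c * 0 ^ Suc d - 0"
    using Suc.prems small unfolding L_def by (intro tendsto_intros) auto
  moreover have "\<forall>\<^sub>F n in sequentially. (\<Sum>i\<le>Suc d. L i n * real n ^ i) * (1 / real n) ^ Suc d
           - (\<Sum>i\<le>d. L i n / real n * (1 / real n) ^ (d - i)) = L (Suc d) n"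
    using eventually_gt_at_top[of 0]
  proof eventually_elim
    case (elim n)
    have "L i n * real n ^ i * (1 / real n) ^ Suc d = L i n / real n * (1 / real n) ^ (d - i)"
      if "i \<le> d" for i
    proof -
      have "d = i + (d - i)" using that by simp
      then have "(1 / real n) ^ Suc d = 1 / real n * ((1 / real n) ^ i * (1 / real n) ^ (d - i))"
        by (metis power_Suc power_add)
      then show ?thesis using elim by (simp add: field_simps)
    qed
    then have "(\<Sum>i\<le>d. L i n * real n ^ i) * (1 / real n) ^ Suc d
        = (\<Sum>i\<le>d. L i n / real n * (1 / real n) ^ (d - i))"
      unfolding sum_distrib_right by (intro sum.cong) auto
    moreover have "L (Suc d) n * real n ^ Suc d * (1 / real n) ^ Suc d = L (Suc d) n"
      using elim by (simp add: power_one_over)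
    ultimately show ?case by (simp add: distrib_right del: power_Suc)
  qed
  ultimately have "(\<lambda>n. L (Suc d) n) \<longlonglongrightarrow> 0" by (simp add: tendsto_cong)
  then have "a (Suc d) = 0" "r (Suc d) = 0"
    using ln_affine_LIMSEQ_imp[of "a (Suc d)" "r (Suc d)" 0] by (simp_all add: L_def)
  then show ?case using Suc by simp
qed

text \<open>The constant term of \<open>R\<close> is the only possible limit of such a sequence, so
  it is required to vanish. \<open>A\<close> is left free, since convergence forces it to be
  0.\<close>

definition log_poly :: "(nat \<Rightarrow> real) \<Rightarrow> bool" where
  "log_poly g \<longleftrightarrow> (\<exists>A R. poly R 0 = 0 \<and>
     (\<forall>n\<ge>1. g n = poly A (real n) * ln (real n) + poly R (real n)))"

lemma log_poly_LIMSEQ_imp: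
  assumes "log_poly g" "g \<longlonglongrightarrow> c"
  shows "c = 0"
proof -
  obtain A R where R: "poly R 0 = 0"
    and g: "\<And>n. n \<ge> 1 \<Longrightarrow> g n = poly A (real n) * ln (real n) + poly R (real n)"
    using assms(1) by (auto simp: log_poly_def)
  define d where "d = max (degree A) (degree R)"
  have expand: "poly P x = (\<Sum>i\<le>d. coeff P i * x ^ i)" if "degree P \<le> d" for P and x :: real
    unfolding poly_altdef using that
    by (intro sum.mono_neutral_left) (auto simp: coeff_eq_0)
  have "\<forall>\<^sub>F n in sequentially.
      g n = (\<Sum>i\<le>d. (coeff A i * ln (real n) + coeff R i) * real n ^ i)"
    using eventually_ge_at_top[of 1]
    by eventually_elim
       (simp add: g expand d_def sum_distrib_left sum_distrib_right sum.distrib[symmetric] algebra_simps)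
  then have "c = coeff R 0"
    using assms(2) by (intro ln_polynomial_LIMSEQ_imp) (auto simp: tendsto_cong)
  then show ?thesis using R by (simp add: poly_0_coeff_0)
qed

section \<open>Closure properties and examples of log-polynomial sequences\<close>

lemma log_poly_add: "log_poly f \<Longrightarrow> log_poly g \<Longrightarrow> log_poly (\<lambda>n. f n + g n)"
  unfolding log_poly_def
proof (elim exE conjE)
  fix A R A' R'
  assume "poly R 0 = 0" "\<forall>n\<ge>1. f n = poly A (real n) * ln (real n) + poly R (real n)"
    "poly R' 0 = 0" "\<forall>n\<ge>1. g n = poly A' (real n) * ln (real n) + poly R' (real n)"
  then show "\<exists>A R. poly R 0 = 0 \<and>
      (\<forall>n\<ge>1. f n + g n = poly A (real n) * ln (real n) + poly R (real n))"
    by (intro exI[of _ "A + A'"] exI[of _ "R + R'"]) (simp add: algebra_simps)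
qed

lemma log_poly_cmult: "log_poly f \<Longrightarrow> log_poly (\<lambda>n. c * f n)"
  unfolding log_poly_def
proof (elim exE conjE)
  fix A R
  assume "poly R 0 = 0" "\<forall>n\<ge>1. f n = poly A (real n) * ln (real n) + poly R (real n)"
  then show "\<exists>A R. poly R 0 = 0 \<and>
      (\<forall>n\<ge>1. c * f n = poly A (real n) * ln (real n) + poly R (real n))"
    by (intro exI[of _ "smult c A"] exI[of _ "smult c R"]) (simp add: algebra_simps)
qed

lemma log_poly_polynomial: "poly R 0 = 0 \<Longrightarrow> log_poly (\<lambda>n. poly R (real n))"
  unfolding log_poly_def by (intro exI[of _ 0] exI[of _ R]) simp

lemma log_poly_polynomial_ln: "log_poly (\<lambda>n. poly A (real n) * ln (real n))"
  unfolding log_poly_def by (intro exI[of _ A] exI[of _ 0]) simp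

lemma log_poly_sum: "(\<And>i. i \<in> I \<Longrightarrow> log_poly (f i)) \<Longrightarrow> log_poly (\<lambda>n. \<Sum>i\<in>I. f i n)"
proof (induction I rule: infinite_finite_induct)
  case (insert x F)
  then show ?case by (simp add: log_poly_add)
qed (use log_poly_polynomial[of 0] in simp_all)

text \<open>The only logarithm-free constant that could occur sits at \<open>r = m\<close>, where
  the Kronecker delta in p(n, m) deletes it. All other logarithm-free terms carry a positive power
  of n.\<close>

lemma log_poly_bendersky_p: "log_poly (\<lambda>n. bendersky_p n m)"
proof -
  define A where "A r = monom (bernoulli_num (r + 1) / fact (r + 1) / fact (m - r)) (m - r)" for r
  define R where "R r = (if m = r then 0 else smult (\<Sum>i = 1..r. 1 / real (m - i + 1)) (A r))" for r
  have "poly (R r) 0 = 0" if "r \<in> {1..m}" for r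
    using that by (auto simp: R_def A_def poly_monom)
  then have "log_poly (\<lambda>n. poly (monom (1 / real (m + 1)) (m + 1) + monom (1 / 2) m) (real n) * ln (real n)
      + poly (monom (- 1 / real (m + 1) ^ 2) (m + 1)) (real n)
      + fact m * (\<Sum>r = 1..m. poly (A r) (real n) * ln (real n) + poly (R r) (real n)))"
    by (intro log_poly_add log_poly_cmult log_poly_sum log_poly_polynomial log_poly_polynomial_ln)
       (simp_all add: poly_monom)
  also have "(\<lambda>n. poly (monom (1 / real (m + 1)) (m + 1) + monom (1 / 2) m) (real n) * ln (real n)
      + poly (monom (- 1 / real (m + 1) ^ 2) (m + 1)) (real n)
      + fact m * (\<Sum>r = 1..m. poly (A r) (real n) * ln (real n) + poly (R r) (real n)))
      = (\<lambda>n. bendersky_p n m)"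
    unfolding bendersky_p_def
    by (intro ext arg_cong2[where f = "(+)"] arg_cong2[where f = "(*)"] sum.cong refl)
       (auto simp: A_def R_def poly_monom distrib_left simp del: fact_Suc)
  finally show ?thesis .
qed

text \<open>Sum \<open>(k + 1)^(p + 1) - k^(p + 1)\<close> over \<open>k\<close> and solve for the power sum of exponent \<open>p\<close>.\<close>

lemma power_sum_polynomial:
  "\<exists>P. poly P 0 = 0 \<and> (\<forall>n. (\<Sum>k = 1..n. real k ^ p) = poly P (real n))"
proof (induction p rule: less_induct)
  case (less p)
  then obtain P where P0: "\<And>i. i < p \<Longrightarrow> poly (P i) 0 = 0"
    and P: "\<And>i n. i < p \<Longrightarrow> (\<Sum>k = 1..n. real k ^ i) = poly (P i) (real n)"
    by metis
  have "real (p + 1) * (\<Sum>k = 1..n. real k ^ p)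
      = (real n + 1) ^ Suc p - 1 - (\<Sum>i<p. real (Suc p choose i) * poly (P i) (real n))" for n
  proof -
    have "(real n + 1) ^ Suc p - 1 = (\<Sum>k = 1..n. (real k + 1) ^ Suc p - real k ^ Suc p)"
      by (induction n) (simp_all add: add_ac)
    also have "\<dots> = (\<Sum>k = 1..n. \<Sum>i\<le>p. real (Suc p choose i) * real k ^ i)"
      by (simp only: binomial_ring[of "real _" 1]) simp
    also have "\<dots> = (\<Sum>i\<le>p. real (Suc p choose i) * (\<Sum>k = 1..n. real k ^ i))"
      by (subst sum.swap) (simp add: sum_distrib_left)
    \<comment> \<open>The top index \<open>i = p\<close> has binomial coefficient
      \<open>p + 1\<close> and isolates the unknown power sum.\<close>
    also have "\<dots> = (\<Sum>i<p. real (Suc p choose i) * poly (P i) (real n))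
        + real (p + 1) * (\<Sum>k = 1..n. real k ^ p)"
      by (simp add: lessThan_Suc_atMost[symmetric] P[simplified])
    finally show ?thesis by simp
  qed
  then have "(\<Sum>k = 1..n. real k ^ p) = poly (smult (1 / real (p + 1))
      ([:1, 1:] ^ Suc p - 1 - (\<Sum>i<p. smult (real (Suc p choose i)) (P i)))) (real n)" for n
    by (simp add: poly_sum field_simps)
  moreover have "poly (smult (1 / real (p + 1))
      ([:1, 1:] ^ Suc p - 1 - (\<Sum>i<p. smult (real (Suc p choose i)) (P i)))) 0 = 0"
    by (simp add: poly_sum P0)
  ultimately show ?case by blast
qed

subsection \<open>The generalized Euler constant and the zeta series\<close>

text \<open>Tonelli's theorem, via unordered sums over pairs, where exchanging coordinates is
  harmless. Columns are summable because \<open>f i j \<le> g i\<close>.\<close>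

lemma suminf_swap_nonneg:
  fixes f :: "nat \<Rightarrow> nat \<Rightarrow> real"
  assumes nonneg: "\<And>i j. 0 \<le> f i j"
    and rows: "\<And>i. f i sums g i"
    and total: "g sums S"
  shows "(\<lambda>j. \<Sum>i. f i j) sums S" and "summable (\<lambda>i. f i j)"
proof -
  have g0: "0 \<le> g i" for i
    by (rule sums_le[OF nonneg sums_zero rows])
  have g: "(g has_sum S) UNIV"
    using total g0 by (rule sums_nonneg_imp_has_sum)
  have row: "(f i has_sum g i) UNIV" for i
    using rows nonneg by (intro sums_nonneg_imp_has_sum)
  have le: "f i j \<le> g i" for i j
    using sum_le_suminf[of "f i" "{j}"] rows[of i] nonneg by (auto simp: sums_iff)
  show col: "summable (\<lambda>i. f i j)" for j
    by (rule summable_comparison_test'[of g 0]) (use total nonneg le in \<open>auto simp: sums_iff\<close>)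
  have "case_prod f summable_on UNIV \<times> UNIV"
    by (rule summable_on_SigmaI[where g = g])
       (use row has_sum_imp_summable[OF g] nonneg in simp_all)
  then have "(case_prod f has_sum S) (UNIV \<times> UNIV)"
    by (intro has_sum_SigmaI[where g = g] g) (use row in simp_all)
  then have swapped: "((\<lambda>(j, i). f i j) has_sum S) (UNIV \<times> UNIV)"
    by (subst (asm) has_sum_swap) simp
  have column: "((\<lambda>i. f i j) has_sum (\<Sum>i. f i j)) UNIV" for j
    by (rule sums_nonneg_imp_has_sum[OF summable_sums[OF col] nonneg])
  have "((\<lambda>j. \<Sum>i. f i j) has_sum S) UNIV"
    by (rule has_sum_SigmaD[OF swapped]) (use column in simp)
  then show "(\<lambda>j. \<Sum>i. f i j) sums S" by (rule has_sum_imp_sums)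
qed

text \<open>Mercator's series for -ln(1 - 1/k), that is, Li_1(1/k).\<close>

lemma ln_ratio_sums:
  assumes "k \<ge> 2"
  shows "(\<lambda>l. (1 / real k) ^ Suc l / real (Suc l)) sums (ln (real k) - ln (real (k - 1)))"
proof -
  have "(\<lambda>n. - ((- (- 1 / real k)) ^ n) / of_nat n) sums ln (1 + (- 1 / real k))"
    using assms by (intro ln_series') auto
  then have "(\<lambda>n. - (- ((- (- 1 / real k)) ^ n) / of_nat n)) sums - ln (1 + (- 1 / real k))"
    by (rule sums_minus)
  then have "(\<lambda>n. (1 / real k) ^ n / real n) sums - ln (1 + (- 1 / real k))" by simp
  \<comment> \<open>The summand at \<open>n = 0\<close> is a division by zero, hence 0, so shifting
    the index keeps the sum.\<close>
  then have "(\<lambda>n. (1 / real k) ^ Suc n / real (Suc n)) sums - ln (1 + (- 1 / real k))"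
    using sums_Suc_iff[of "\<lambda>n. (1 / real k) ^ n / real n"] by simp
  moreover have "1 + (- 1 / real k) = real (k - 1) / real k"
    using assms by (simp add: field_simps of_nat_diff)
  then have "- ln (1 + (- 1 / real k)) = ln (real k) - ln (real (k - 1))"
    using assms by (simp add: ln_div)
  ultimately show ?thesis by simp
qed

text \<open>With k = n + 2 and j = l + 1 this is k^(-1-j) / (j + \<mu>). Summed over k it is the
  j-th term of D(1, 1; \<mu>); summed over j it is the tail of k^(\<mu>-1) Li_1(1/k) beyond its
  first \<mu> terms.\<close>

definition tail_term :: "nat \<Rightarrow> nat \<Rightarrow> nat \<Rightarrow> real" where
  "tail_term \<mu> n l = (1 / real (n + 2)) ^ (l + 2) / real (l + 1 + \<mu>)"

text \<open>The terms \<open>l \<le> \<mu>\<close> of the logarithmic series cancel the finite sum in \<open>\<gamma>(1, 1; \<mu>)\<close>.\<close>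

lemma tail_term_sums:
  "tail_term (Suc \<nu>) n sums
     (real (n + 2) ^ \<nu> * (ln (real (n + 2)) - ln (real (n + 1)))
      - (\<Sum>l = 1..Suc \<nu>. 1 / real l * (real (n + 2) ^ \<nu> / real (n + 2) ^ l)))"
proof -
  define x where "x = real (n + 2)"
  have x: "x > 0" by (simp add: x_def)
  have "(\<lambda>l. (1 / x) ^ Suc (l + Suc \<nu>) / real (Suc (l + Suc \<nu>))) sums
      (ln x - ln (real (n + 1)) - (\<Sum>l<Suc \<nu>. (1 / x) ^ Suc l / real (Suc l)))"
    using sums_split_initial_segment[OF ln_ratio_sums[of "n + 2"], of "Suc \<nu>"] by (simp add: x_def)
  then have "(\<lambda>l. x ^ \<nu> * ((1 / x) ^ Suc (l + Suc \<nu>) / real (Suc (l + Suc \<nu>)))) sums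
      (x ^ \<nu> * (ln x - ln (real (n + 1)) - (\<Sum>l<Suc \<nu>. (1 / x) ^ Suc l / real (Suc l))))"
    by (rule sums_mult)
  moreover have "x ^ \<nu> * ((1 / x) ^ Suc (l + Suc \<nu>) / real (Suc (l + Suc \<nu>))) = tail_term (Suc \<nu>) n l" for l
  proof -
    have "(1 / x) ^ Suc (l + Suc \<nu>) = (1 / x) ^ \<nu> * (1 / x) ^ (l + 2)"
      by (simp add: power_add[symmetric] add_ac)
    then show ?thesis using x unfolding tail_term_def x_def[symmetric] by (simp add: power_one_over add_ac)
  qed
  moreover have "x ^ \<nu> * (\<Sum>l<Suc \<nu>. (1 / x) ^ Suc l / real (Suc l))
      = (\<Sum>l = 1..Suc \<nu>. 1 / real l * (x ^ \<nu> / x ^ l))"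
    unfolding One_nat_def sum.atLeast1_atMost_eq sum_distrib_left
    by (intro sum.cong refl) (simp add: power_one_over del: of_nat_Suc power_Suc)
  ultimately show ?thesis by (simp add: x_def right_diff_distrib)
qed

text \<open>Dropping the denominator leaves a geometric series of ratio q = 1/(n+2), whose sum
  q^2/(1-q) = 1/((n+1)(n+2)) is at most 1/(n+1)^2.\<close>

lemma tail_term_summable: "summable (\<lambda>n. \<Sum>l. tail_term \<mu> n l)"
proof (rule summable_comparison_test'[of "\<lambda>n. 1 / (real (n + 1))\<^sup>2" 0])
  show "summable (\<lambda>n. 1 / (real (n + 1))\<^sup>2)"
    using inverse_power_summable[of 2, where 'a = real]
    by (subst summable_iff_shift[of "\<lambda>n. 1 / (real n)\<^sup>2" 1]) (simp add: field_simps)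
  fix n :: nat
  define q where "q = 1 / real (n + 2)"
  have q: "0 < q" "q < 1" by (simp_all add: q_def)
  have geo: "(\<lambda>l. q ^ 2 * q ^ l) sums (q ^ 2 * (1 / (1 - q)))"
    using q by (intro sums_mult geometric_sums) simp
  have le: "tail_term \<mu> n l \<le> q ^ 2 * q ^ l" for l
  proof -
    have "tail_term \<mu> n l \<le> q ^ (l + 2) / 1"
      unfolding tail_term_def q_def[symmetric] using q by (intro divide_left_mono) auto
    then show ?thesis by (simp add: power_add power2_eq_square mult_ac)
  qed
  have nonneg: "0 \<le> tail_term \<mu> n l" for l by (simp add: tail_term_def)
  have sm: "summable (tail_term \<mu> n)"
    by (rule summable_comparison_test'[of "\<lambda>l. q ^ 2 * q ^ l" 0]) (use geo le nonneg in \<open>auto simp: sums_iff\<close>)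
  have "(\<Sum>l. tail_term \<mu> n l) \<le> q ^ 2 * (1 / (1 - q))"
    using suminf_le[OF le sm] geo by (simp add: sums_iff)
  also have "\<dots> = 1 / (real (n + 2) * real (n + 1))"
  proof -
    have "1 - q = real (n + 1) * q" by (simp add: q_def field_simps)
    then show ?thesis using q(1) by (simp add: power2_eq_square) (simp add: q_def)
  qed
  also have "\<dots> \<le> 1 / (real (n + 1))\<^sup>2"
    unfolding power2_eq_square by (intro divide_left_mono mult_right_mono) auto
  finally show "norm (\<Sum>l. tail_term \<mu> n l) \<le> 1 / (real (n + 1))\<^sup>2"
    using suminf_nonneg[OF sm nonneg] by simp
qed

section \<open>Zeta values at integers and the series D(1, 1; \<mu>)\<close>

lemma riemann_zeta_of_nat_minus_1:
  "riemann_zeta (1 + of_nat (Suc l)) - 1 = of_real (\<Sum>n. (1 / real (n + 2)) ^ (l + 2))"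
proof -
  define f where "f n = (1 / real (n + 1)) ^ (l + 2)" for n
  have "1 / of_nat (Suc n) powr (1 + of_nat (Suc l)) = complex_of_real (f n)" for n
  proof -
    have "of_nat (Suc n) powr (1 + of_nat (Suc l)) = (of_nat (Suc n) powr of_nat (l + 2) :: complex)"
      by (simp add: add_ac)
    also have "\<dots> = of_nat (Suc n) ^ (l + 2)"
      by (rule powr_nat') auto
    finally show ?thesis by (simp add: f_def power_one_over)
  qed
  \<comment> \<open>The argument equals \<open>l + 2\<close>, so the Dirichlet series branch of the
    definition applies.\<close>
  then have zeta: "riemann_zeta (1 + of_nat (Suc l)) = (\<Sum>n. complex_of_real (f n))"
    by (simp add: riemann_zeta_def)
  have "summable (\<lambda>n. (1 / real n) ^ (l + 2))"
    using inverse_power_summable[of "l + 2", where 'a = real] by (simp add: field_simps)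
  then have sm: "summable f"
    unfolding f_def by (subst summable_iff_shift[of "\<lambda>n. (1 / real n) ^ (l + 2)" 1])
  have "(\<Sum>n. f (Suc n)) = suminf f - 1"
    using suminf_split_head[OF sm] by (simp add: f_def)
  moreover have "f (Suc n) = (1 / real (n + 2)) ^ (l + 2)" for n
    by (simp add: f_def add_ac)
  ultimately show ?thesis
    by (simp only: zeta suminf_of_real[OF sm, symmetric] of_real_diff of_real_1)
qed

lemma D_series_1_1:
  assumes "\<mu> \<ge> 1"
  shows "D_series 1 1 (of_nat \<mu>) = of_real (\<Sum>n. \<Sum>l. tail_term \<mu> n l)"
proof -
  obtain \<nu> where \<nu>: "\<mu> = Suc \<nu>" using assms by (cases \<mu>) auto
  have sw: "(\<lambda>l. \<Sum>n. tail_term \<mu> n l) sums (\<Sum>n. \<Sum>l. tail_term \<mu> n l)"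
  proof (rule suminf_swap_nonneg)
    show "0 \<le> tail_term \<mu> n l" for n l by (simp add: tail_term_def)
    show "tail_term \<mu> n sums (\<Sum>l. tail_term \<mu> n l)" for n
      unfolding \<nu> by (rule summable_sums[OF sums_summable[OF tail_term_sums]])
    show "(\<lambda>n. \<Sum>l. tail_term \<mu> n l) sums (\<Sum>n. \<Sum>l. tail_term \<mu> n l)"
      by (rule summable_sums[OF tail_term_summable])
  qed
  have "(riemann_zeta (1 + of_nat (Suc l)) - 1) / (of_nat (Suc l) + of_nat \<mu>) powr 1
      = complex_of_real (\<Sum>n. tail_term \<mu> n l)" for l
  proof -
    have "summable (\<lambda>n. (1 / real n) ^ (l + 2))"
      using inverse_power_summable[of "l + 2", where 'a = real] by (simp add: field_simps)
    then have "summable (\<lambda>n. (1 / real (n + 2)) ^ (l + 2))"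
      by (subst summable_iff_shift[of "\<lambda>n. (1 / real n) ^ (l + 2)" 2])
    then have "(\<Sum>n. tail_term \<mu> n l) = (\<Sum>n. (1 / real (n + 2)) ^ (l + 2)) / real (l + 1 + \<mu>)"
      unfolding tail_term_def by (simp only: suminf_divide)
    moreover have "(of_nat (Suc l) + of_nat \<mu> :: complex) powr 1 = complex_of_real (real (l + 1 + \<mu>))"
      by (simp add: powr_to_1 add_ac)
    ultimately show ?thesis by (simp only: riemann_zeta_of_nat_minus_1 of_real_divide)
  qed
  then show ?thesis
    unfolding D_series_def using sums_of_real[OF sw, where 'a = complex] by (simp add: sums_iff)
qed

section \<open>The sequence defining \<gamma>(1, 1; \<mu>) and its limit\<close>

definition euler_seq :: "nat \<Rightarrow> nat \<Rightarrow> real" where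
  "euler_seq \<mu> N = (\<Sum>l = 1..\<mu>. 1 / real l * (\<Sum>k = 1..N. real k ^ (\<mu> - 1) / real k ^ l))
     - (\<Sum>k = 2..N. real k ^ (\<mu> - 1) * (ln (real k) - ln (real (k - 1))))"

lemma gen_euler_const_eq_lim:
  assumes "\<mu> \<ge> 1"
  shows "gen_euler_const 1 1 \<mu> = lim (\<lambda>N. complex_of_real (euler_seq \<mu> N))"
proof -
  have pow: "(of_nat k :: complex) powr (of_nat \<mu> - 1) = complex_of_real (real k ^ (\<mu> - 1))"
    if "k \<ge> 1" for k
  proof -
    have "(of_nat k :: complex) powr (of_nat \<mu> - 1) = of_nat k powr of_nat (\<mu> - 1)"
      using assms by (simp add: of_nat_diff)
    also have "\<dots> = of_nat k ^ (\<mu> - 1)" using that by (intro powr_nat') auto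
    finally show ?thesis by simp
  qed
  \<comment> \<open>At \<open>l = \<mu>\<close> the exponent of \<open>k\<close> is -1, hence a
    quotient of natural powers on the real side.\<close>
  have term1: "1 / (of_nat k :: complex) powr (1 + of_nat l - of_nat \<mu>)
      = complex_of_real (real k ^ (\<mu> - 1) / real k ^ l)" if "k \<ge> 1" for k l
  proof -
    have "1 / (of_nat k :: complex) powr (1 + of_nat l - of_nat \<mu>)
        = of_nat k powr ((of_nat \<mu> - 1) - of_nat l)"
      using powr_minus_divide[of "of_nat k :: complex" "1 + of_nat l - of_nat \<mu>"] by (simp add: algebra_simps)
    also have "\<dots> = of_nat k powr (of_nat \<mu> - 1) / of_nat k powr of_nat l"
      by (rule powr_diff)
    also have "(of_nat k :: complex) powr of_nat l = of_nat k ^ l"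
      using that by (intro powr_nat') auto
    finally show ?thesis using pow[OF that] by simp
  qed
  have li: "polylog 1 (1 / of_nat k) = complex_of_real (ln (real k) - ln (real (k - 1)))"
    if "k \<ge> 2" for k
  proof -
    have "(1 / of_nat k :: complex) ^ Suc l / of_nat (Suc l) powr 1
        = complex_of_real ((1 / real k) ^ Suc l / real (Suc l))" for l
      by (simp add: powr_to_1 del: of_nat_Suc power_Suc)
    then show ?thesis
      unfolding polylog_def using sums_of_real[OF ln_ratio_sums[OF that], where 'a = complex]
      by (simp only: sums_iff)
  qed
  show ?thesis
    unfolding gen_euler_const_def euler_seq_def
    by (intro arg_cong[where f = lim] ext) (simp add: powr_to_1 term1 pow li mult_ac)
qed

text \<open>At N = 1 the sum from k = 2 is empty and only \<open>harm \<mu>\<close> is left; each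
  further N subtracts exactly one row sum of \<open>tail_term\<close>.\<close>

lemma euler_seq_LIMSEQ:
  assumes "\<mu> \<ge> 1"
  shows "euler_seq \<mu> \<longlonglongrightarrow> harm \<mu> - (\<Sum>n. \<Sum>l. tail_term \<mu> n l)"
proof -
  obtain \<nu> where \<nu>: "\<mu> = Suc \<nu>" using assms by (cases \<mu>) auto
  have partial: "euler_seq \<mu> (Suc N) = harm \<mu> - (\<Sum>n<N. \<Sum>l. tail_term \<mu> n l)" for N
  proof (induction N)
    case 0
    show ?case by (simp add: euler_seq_def harm_def inverse_eq_divide)
  next
    case (Suc N)
    define x where "x = real (Suc (Suc N))"
    define c where "c = (\<Sum>l = 1..\<mu>. 1 / real l * (x ^ \<nu> / x ^ l))"
    have "(\<Sum>l = 1..\<mu>. 1 / real l * (\<Sum>k = 1..Suc (Suc N). real k ^ \<nu> / real k ^ l))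
        = (\<Sum>l = 1..\<mu>. 1 / real l * (\<Sum>k = 1..Suc N. real k ^ \<nu> / real k ^ l)) + c"
      by (simp add: c_def x_def distrib_left sum.distrib del: of_nat_Suc)
    moreover have "(\<Sum>k = 2..Suc (Suc N). real k ^ \<nu> * (ln (real k) - ln (real (k - 1))))
        = (\<Sum>k = 2..Suc N. real k ^ \<nu> * (ln (real k) - ln (real (k - 1))))
          + x ^ \<nu> * (ln x - ln (real (Suc N)))"
      by (simp add: x_def del: of_nat_Suc)
    moreover have "(\<Sum>l. tail_term \<mu> N l) = x ^ \<nu> * (ln x - ln (real (Suc N))) - c"
      using tail_term_sums[of \<nu> N] by (simp add: sums_iff x_def c_def \<nu> add_ac)
    ultimately have "euler_seq \<mu> (Suc (Suc N)) - euler_seq \<mu> (Suc N) = - (\<Sum>l. tail_term \<mu> N l)"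
      unfolding euler_seq_def by (simp add: \<nu>)
    then show ?case using Suc by simp
  qed
  have "(\<lambda>N. harm \<mu> - (\<Sum>n<N. \<Sum>l. tail_term \<mu> n l)) \<longlonglongrightarrow> harm \<mu> - (\<Sum>n. \<Sum>l. tail_term \<mu> n l)"
    by (intro tendsto_intros summable_LIMSEQ tail_term_summable)
  then show ?thesis by (simp only: partial[symmetric] filterlim_sequentially_Suc)
qed

text \<open>Moving the difference from the logarithm to the weight produces (k+1)^\<nu> - k^\<nu>,
  whose binomial expansion supplies the coefficients. The boundary weight is (N+1)^\<nu> because the
  inner sums include k = N.\<close>

lemma abel_summation_power_ln:
  assumes "N \<ge> 1"
  shows "(\<Sum>k = 2..N. real k ^ \<nu> * (ln (real k) - ln (real (k - 1))))
    = (real N + 1) ^ \<nu> * ln (real N)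
      - (\<Sum>j<\<nu>. real (\<nu> choose j) * (\<Sum>k = 1..N. real k ^ j * ln (real k)))"
  using assms
proof (induction N rule: nat_induct_at_least)
  case base
  show ?case by simp
next
  case (Suc N)
  have binom: "(real (Suc N) + 1) ^ \<nu> = (\<Sum>j<\<nu>. real (\<nu> choose j) * real (Suc N) ^ j) + real (Suc N) ^ \<nu>"
    by (simp only: binomial_ring[of "real (Suc N)" 1]) (simp add: lessThan_Suc_atMost[symmetric])
  have weighted: "(\<Sum>j<\<nu>. real (\<nu> choose j) * (\<Sum>k = 1..Suc N. real k ^ j * ln (real k)))
      = (\<Sum>j<\<nu>. real (\<nu> choose j) * (\<Sum>k = 1..N. real k ^ j * ln (real k)))
        + (\<Sum>j<\<nu>. real (\<nu> choose j) * real (Suc N) ^ j) * ln (real (Suc N))"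
    by (simp add: distrib_left sum.distrib sum_distrib_right mult.assoc del: of_nat_Suc)
  have last: "(\<Sum>k = 2..Suc N. real k ^ \<nu> * (ln (real k) - ln (real (k - 1))))
      = (\<Sum>k = 2..N. real k ^ \<nu> * (ln (real k) - ln (real (k - 1))))
        + real (Suc N) ^ \<nu> * (ln (real (Suc N)) - ln (real N))"
    using Suc.hyps by simp
  have IH: "(\<Sum>k = 2..N. real k ^ \<nu> * (ln (real k) - ln (real (k - 1))))
      = real (Suc N) ^ \<nu> * ln (real N)
        - (\<Sum>j<\<nu>. real (\<nu> choose j) * (\<Sum>k = 1..N. real k ^ j * ln (real k)))"
    using Suc.IH by (simp only: of_nat_Suc add.commute)
  have linear: "q * l - u + q * (L - l) = (w + q) * L - (u + w * L)" for l L q u w :: real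
    by (simp add: algebra_simps)
  show ?case unfolding last IH weighted binom by (rule linear)
qed

text \<open>The summand \<open>l = Suc \<nu>\<close> of \<open>euler_seq\<close> gives the harmonic
  number; those with \<open>l \<le> \<nu>\<close> are power sums, hence polynomials without constant
  term.\<close>

lemma euler_seq_eq_log_poly:
  "\<exists>g. log_poly g \<and>
     (\<forall>N\<ge>1. euler_seq (Suc \<nu>) N = 1 / real (Suc \<nu>) * (harm N - ln (real N))
           + (\<Sum>j<\<nu>. real (\<nu> choose j) *
                ((\<Sum>k = 1..N. real k ^ j * ln (real k)) - bendersky_p N j)) + g N)"
proof -
  \<comment> \<open>In order: compensation for the \<open>ln N\<close> subtracted from
    \<open>harm N\<close>, the power sums, the Abel boundary term, and compensation for the
    subtracted Bendersky polynomials.\<close>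
  define g where "g N = 1 / real (Suc \<nu>) * (poly 1 (real N) * ln (real N))
      + (\<Sum>l = 1..\<nu>. 1 / real l * (\<Sum>k = 1..N. real k ^ (\<nu> - l)))
      + (- 1) * (poly ([:1, 1:] ^ \<nu>) (real N) * ln (real N))
      + (\<Sum>j<\<nu>. real (\<nu> choose j) * bendersky_p N j)" for N
  have "log_poly (\<lambda>N. \<Sum>k = 1..N. real k ^ p)" for p
    using power_sum_polynomial[of p] log_poly_polynomial by auto
  then have "log_poly g" unfolding g_def
    by (intro log_poly_add log_poly_sum log_poly_cmult log_poly_polynomial_ln log_poly_bendersky_p)
  moreover have "euler_seq (Suc \<nu>) N = 1 / real (Suc \<nu>) * (harm N - ln (real N))
      + (\<Sum>j<\<nu>. real (\<nu> choose j) *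
           ((\<Sum>k = 1..N. real k ^ j * ln (real k)) - bendersky_p N j)) + g N" if N: "N \<ge> 1" for N
  proof -
    have "(\<Sum>l = 1..\<nu>. 1 / real l * (\<Sum>k = 1..N. real k ^ \<nu> / real k ^ l))
        = (\<Sum>l = 1..\<nu>. 1 / real l * (\<Sum>k = 1..N. real k ^ (\<nu> - l)))"
      by (intro sum.cong refl arg_cong2[where f = "(*)"]) (auto simp: power_diff)
    moreover have "(\<Sum>k = 1..N. real k ^ \<nu> / real k ^ Suc \<nu>) = harm N"
      unfolding harm_def by (intro sum.cong refl) (auto simp: field_simps)
    ultimately have "(\<Sum>l = 1..Suc \<nu>. 1 / real l * (\<Sum>k = 1..N. real k ^ \<nu> / real k ^ l))
        = (\<Sum>l = 1..\<nu>. 1 / real l * (\<Sum>k = 1..N. real k ^ (\<nu> - l))) + 1 / real (Suc \<nu>) * harm N"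
      by (simp del: of_nat_Suc power_Suc)
    then show ?thesis
      using abel_summation_power_ln[OF N, of \<nu>]
      unfolding euler_seq_def g_def
      by (simp add: right_diff_distrib sum_subtractf add.commute del: of_nat_Suc power_Suc sum.cl_ivl_Suc)
  qed
  ultimately show ?thesis by blast
qed

theorem theorem2p3:
  fixes \<mu> :: nat
  assumes "\<mu> \<ge> 1"
  shows "gen_euler_const 1 1 \<mu> =
           complex_of_real (1 / real \<mu> * euler_mascheroni
             + (\<Sum>j<\<mu> - 1. real ((\<mu> - 1) choose j) * ln (bendersky_const j)))
       \<and> D_series 1 1 (of_nat \<mu>) =
           complex_of_real (harm \<mu> - 1 / real \<mu> * euler_mascheroni
             - (\<Sum>j<\<mu> - 1. real ((\<mu> - 1) choose j) * ln (bendersky_const j)))"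
proof -
  obtain \<nu> where \<nu>: "\<mu> = Suc \<nu>" using assms by (cases \<mu>) auto
  define T where "T = (\<Sum>n. \<Sum>l. tail_term \<mu> n l)"
  define V where "V = 1 / real \<mu> * euler_mascheroni + (\<Sum>j<\<nu>. real (\<nu> choose j) * ln (bendersky_const j))"
  define h where "h N = 1 / real \<mu> * (harm N - ln (real N)) + (\<Sum>j<\<nu>. real (\<nu> choose j) *
      ((\<Sum>k = 1..N. real k ^ j * ln (real k)) - bendersky_p N j))" for N
  obtain g where g: "log_poly g" "\<And>N. N \<ge> 1 \<Longrightarrow> euler_seq \<mu> N = h N + g N"
    using euler_seq_eq_log_poly[of \<nu>] unfolding h_def \<nu> by blast
  have seq: "euler_seq \<mu> \<longlonglongrightarrow> harm \<mu> - T"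
    unfolding T_def by (rule euler_seq_LIMSEQ[OF assms])
  have "h \<longlonglongrightarrow> V"
    unfolding h_def V_def by (intro tendsto_intros euler_mascheroni_LIMSEQ bendersky_LIMSEQ)
  with seq have "(\<lambda>N. euler_seq \<mu> N - h N) \<longlonglongrightarrow> harm \<mu> - T - V" by (rule tendsto_diff)
  moreover have "\<forall>\<^sub>F N in sequentially. euler_seq \<mu> N - h N = g N"
    using eventually_ge_at_top[of 1] by eventually_elim (simp add: g(2))
  ultimately have "g \<longlonglongrightarrow> harm \<mu> - T - V" by (simp add: tendsto_cong)
  \<comment> \<open>The limit of \<open>g\<close> must be 0, which equates the double-series value
    of the limit with the closed form \<open>V\<close>.\<close>
  from log_poly_LIMSEQ_imp[OF g(1) this] have V: "harm \<mu> - T = V" by simp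
  have "(\<lambda>N. complex_of_real (euler_seq \<mu> N)) \<longlonglongrightarrow> of_real V"
    using seq unfolding V by (rule tendsto_of_real)
  then have "gen_euler_const 1 1 \<mu> = of_real V"
    using gen_euler_const_eq_lim[OF assms] by (simp add: limI)
  moreover have "D_series 1 1 (of_nat \<mu>) = of_real (harm \<mu> - V)"
    using D_series_1_1[OF assms] unfolding V[symmetric] T_def by simp
  ultimately show ?thesis by (simp add: V_def \<nu> diff_diff_eq del: of_nat_Suc)
qed

end
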